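(* Let $K\subset\mathbb R^3$ be a convex body which contains a ball $\mathcal B$ in its interior. Suppose that for every plane $\Pi$ tangent to $\mathcal B$, the section $\Pi\cap K$ has an equipotential circle whose centre is the contact point of $\Pi$ with $\mathcal B$. Then $K$ is a ball.
   Context: A convex body is a compact convex set with nonempty interior. Given a planar convex body $M$ (contained in a plane $\Pi$, with interior and boundary taken relative to $\Pi$), a circle $\Omega\subset \operatorname{int} M$ (of positive radius) is an equipotential circle of $M$ if there is a constant $\lambda$ such that for every line in $\Pi$ tangent to $\Omega$, with contact point $T$ and cutting $M$ in the chord $AB$ (with $A,B\in\partial M$), one has $|AT|\cdot|TB|=\lambda$. The circle and the constant may depend on the section. *)

theory Defs
  imports "HOL-Analysis.Analysis"
begin

definition convex_body :: "'a::euclidean_space set \<Rightarrow> bool" where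
  "convex_body K \<longleftrightarrow> compact K \<and> convex K \<and> interior K \<noteq> {}"

definition is_line :: "'a::euclidean_space set \<Rightarrow> bool" where
  "is_line L \<longleftrightarrow> affine L \<and> aff_dim L = 1"

definition is_plane :: "'a::euclidean_space set \<Rightarrow> bool" where
  "is_plane P \<longleftrightarrow> affine P \<and> aff_dim P = 2"

text \<open>Tangency is meeting in exactly one point. This is used for a plane and a closed ball in
  space, and for a line and a circle lying in a common plane.\<close>

definition tangent_plane_at :: "'a::euclidean_space set \<Rightarrow> 'a set \<Rightarrow> 'a \<Rightarrow> bool" where
  "tangent_plane_at P B p \<longleftrightarrow> is_plane P \<and> P \<inter> B = {p}"

definition tangent_line_at :: "'a::euclidean_space set \<Rightarrow> 'a set \<Rightarrow> 'a \<Rightarrow> bool" where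
  "tangent_line_at L C t \<longleftrightarrow> is_line L \<and> L \<inter> C = {t}"

definition circle_in_plane :: "'a::euclidean_space set \<Rightarrow> 'a \<Rightarrow> 'a set \<Rightarrow> bool" where
  "circle_in_plane P p C \<longleftrightarrow> is_plane P \<and> p \<in> P \<and> (\<exists>\<rho>>0. C = P \<inter> sphere p \<rho>)"

text \<open>Interior and boundary of \<open>M\<close> are those of the subspace topology of the plane \<open>P\<close>.
  Requiring \<open>L \<inter> M = closed_segment a b\<close> makes \<open>a\<close>, \<open>b\<close> the two endpoints of the
  chord; merely taking boundary points on \<open>L\<close> would also allow \<open>a = b\<close>.\<close>

definition is_chord :: "'a::euclidean_space set \<Rightarrow> 'a set \<Rightarrow> 'a set \<Rightarrow> 'a \<Rightarrow> 'a \<Rightarrow> bool" where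
  "is_chord P M L a b \<longleftrightarrow>
     L \<inter> M = closed_segment a b \<and>
     a \<in> top_of_set P frontier_of M \<and> b \<in> top_of_set P frontier_of M"

text \<open>\<open>equipotential_circle P M p C\<close>: \<open>C\<close>, with centre \<open>p\<close>, is an equipotential circle of the
  convex body \<open>M\<close> of the plane \<open>P\<close>.\<close>

definition equipotential_circle ::
    "'a::euclidean_space set \<Rightarrow> 'a set \<Rightarrow> 'a \<Rightarrow> 'a set \<Rightarrow> bool" where
  "equipotential_circle P M p C \<longleftrightarrow>
     circle_in_plane P p C \<and>
     C \<subseteq> top_of_set P interior_of M \<and>
     (\<exists>k::real. \<forall>L t a b. L \<subseteq> P \<and> tangent_line_at L C t \<and> is_chord P M L a b
        \<longrightarrow> dist a t * dist t b = k)"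

end

theory Submission
  imports Defs
begin

text \<open>In a tangent plane \<open>\<Pi>\<close> with contact point \<open>p\<close>, the tangent from a boundary point \<open>A\<close> at
  distance \<open>d\<close> from \<open>p\<close> leads to a boundary point \<open>B\<close> whose distance from \<open>p\<close> depends on \<open>d\<close> only;
  the next tangent, from \<open>B\<close>, leads back to distance \<open>d\<close>. Hence the boundary points of \<open>\<Pi> \<inter> K\<close> at
  distance \<open>d\<close> are invariant under a rotation about \<open>p\<close> by some \<open>\<theta> \<in> (0, 2\<pi>)\<close>, and, the set being
  closed, under the rotation by \<open>2\<pi>/n\<close> for some \<open>n \<ge> 2\<close>. Nothing is known about how \<open>n\<close> depends on
  \<open>\<Pi>\<close>, but there are only countably many choices. Fix a boundary point \<open>A\<close> at distance \<open>D\<close> from the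
  centre \<open>c\<close> of the given ball and apply two such rotations in succession, in a tangent plane through
  \<open>A\<close> and then in one through the resulting point: the two planes give two parameters, and by Baire
  some fixed pair \<open>(n, m)\<close> works on an open set of parameters. The points reached fill an open piece
  of the sphere of radius \<open>D\<close>. So every level set of the distance from \<open>c\<close> on \<open>\<partial>K\<close> contains an open
  patch, there are only countably many levels, and since \<open>\<partial>K\<close> is connected there is only one.\<close>

subsection \<open>Orthonormal triples\<close>

text \<open>No orientation is prescribed, so in dimension three a statement about all frames \<open>u\<close>, \<open>w\<close>, \<open>w'\<close>
  covers both senses of rotation about \<open>u\<close>.\<close>

definition frame :: "'a::real_inner \<Rightarrow> 'a \<Rightarrow> 'a \<Rightarrow> bool" where
  "frame a b c \<longleftrightarrow> a \<bullet> a = 1 \<and> b \<bullet> b = 1 \<and> c \<bullet> c = 1 \<and> a \<bullet> b = 0 \<and> a \<bullet> c = 0 \<and> b \<bullet> c = 0"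

lemma frameD:
  assumes "frame a b c"
  shows "a \<bullet> a = 1" "b \<bullet> b = 1" "c \<bullet> c = 1" "a \<bullet> b = 0" "a \<bullet> c = 0" "b \<bullet> c = 0"
    "b \<bullet> a = 0" "c \<bullet> a = 0" "c \<bullet> b = 0"
  using assms by (auto simp: frame_def inner_commute)

lemma frame_swap: "frame a b c \<Longrightarrow> frame b a c" "frame a b c \<Longrightarrow> frame a c b"
  "frame a b c \<Longrightarrow> frame b c a"
  by (auto simp: frame_def inner_commute)

text \<open>The coefficient matrix is a reflection, hence its own inverse: combining the two new
  vectors with coefficients \<open>x\<close>, \<open>y\<close> gives back \<open>a\<close>. This is
  how a frame is tilted so as to reach a prescribed point.\<close>

lemma frame_rotate:
  assumes "frame a b c" "x\<^sup>2 + y\<^sup>2 = 1"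
  shows "frame (x *\<^sub>R a + y *\<^sub>R b) (y *\<^sub>R a - x *\<^sub>R b) c"
  using assms(2) unfolding frame_def
  by (simp add: frameD[OF assms(1)] inner_simps power2_eq_square algebra_simps)

lemma norm_frame:
  assumes "frame a b c"
  shows "(norm (x *\<^sub>R a + y *\<^sub>R b + z *\<^sub>R c))\<^sup>2 = x\<^sup>2 + y\<^sup>2 + z\<^sup>2"
  unfolding power2_norm_eq_inner
  by (simp add: frameD[OF assms] inner_simps power2_eq_square)

lemma frame_expand:
  fixes a b c v :: "real ^ 3"
  assumes "frame a b c"
  shows "v = (v \<bullet> a) *\<^sub>R a + (v \<bullet> b) *\<^sub>R b + (v \<bullet> c) *\<^sub>R c"
proof -
  let ?S = "{a, b, c}"
  have ne: "a \<noteq> b" "a \<noteq> c" "b \<noteq> c" "0 \<notin> ?S"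
    using frameD[OF assms] by auto
  have "pairwise orthogonal ?S"
    using frameD[OF assms] by (auto simp: pairwise_def orthogonal_def)
  then have "independent ?S"
    using ne by (simp add: pairwise_orthogonal_independent)
  moreover have "card ?S = 3" using ne by simp
  ultimately have span: "span ?S = UNIV"
    using card_eq_dim[of ?S UNIV] by auto
  define w where "w = v - ((v \<bullet> a) *\<^sub>R a + (v \<bullet> b) *\<^sub>R b + (v \<bullet> c) *\<^sub>R c)"
  have "orthogonal w y" if "y \<in> ?S" for y
    using that frameD[OF assms] by (auto simp: w_def orthogonal_def inner_simps)
  then have "orthogonal w w"
    using orthogonal_to_span[of w ?S w] span by auto
  then show ?thesis by (simp add: w_def orthogonal_def)
qed

lemma frame_exists:
  fixes a :: "real ^ 3"
  assumes "norm a = 1"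
  obtains b c where "frame a b c"
proof -
  obtain b where b: "norm b = 1" "orthogonal a b"
  proof -
    obtain y where "y \<noteq> 0" "orthogonal a y"
      using orthogonal_to_vector_exists[of a] by (auto simp: orthogonal_commute)
    then show thesis
      using that[of "y /\<^sub>R norm y"] by (simp add: orthogonal_def)
  qed
  have "norm (cross3 a b) = 1"
  proof -
    have "(norm (cross3 a b))\<^sup>2 = 1\<^sup>2"
      using norm_cross_dot[of a b] b assms by (simp add: orthogonal_def)
    then show ?thesis by (simp add: norm_eq_1 power2_norm_eq_inner)
  qed
  then show ?thesis
    using that[of b "cross3 a b"] assms b
    by (simp add: frame_def norm_eq_1 orthogonal_def dot_cross_self inner_commute)
qed

subsection \<open>Angles and category\<close>

text \<open>The orbit of 0 consists of the multiples of \<theta> modulo \<open>2 * pi\<close>. If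
  \<theta> / (2 pi) is a reduced fraction with denominator \<open>q\<close>, Bezout puts
  \<open>2 * pi / q\<close> into it; otherwise the orbit is dense modulo \<open>2 * pi\<close> and
  closedness gives \<open>pi\<close>. An arbitrary angle is thus traded for one from a countable
  list.\<close>

lemma rotation_closed_set_contains_fraction:
  fixes T :: "real set"
  assumes "closed T" "0 \<in> T" "0 < \<theta>" "\<theta> < 2 * pi"
    and rot: "\<And>t. t \<in> T \<Longrightarrow> t + \<theta> \<in> T"
    and per: "\<And>t. t \<in> T \<Longrightarrow> t - 2 * pi \<in> T"
  obtains n :: nat where "n \<ge> 2" "2 * pi / n \<in> T"
proof -
  define s where "s = \<theta> / (2 * pi)"
  have s: "0 < s" "s < 1" "\<theta> = 2 * pi * s" using assms by (auto simp: s_def)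
  have k: "real k * \<theta> \<in> T" for k
  proof (induction k)
    case (Suc k)
    then show ?case using rot[OF Suc] by (simp add: algebra_simps)
  qed (use assms(2) in simp)
  have km: "real k * \<theta> - 2 * pi * real m \<in> T" for k m
    by (induction m) (use k per in \<open>force simp: algebra_simps\<close>)+
  \<comment> \<open>As \<open>s\<close> is positive the floor is nonnegative, so reducing modulo
    \<open>2 * pi\<close> only takes subtractions, which \<open>per\<close> allows.\<close>
  have fr: "2 * pi * frac (real k * s) \<in> T" for k
  proof -
    have "real_of_int \<lfloor>real k * s\<rfloor> = real (nat \<lfloor>real k * s\<rfloor>)"
      using s by (simp add: zero_le_floor)
    then have "2 * pi * frac (real k * s) = real k * \<theta> - 2 * pi * real (nat \<lfloor>real k * s\<rfloor>)"
      unfolding frac_def s(3) by (simp add: algebra_simps)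
    then show ?thesis using km by simp
  qed
  show ?thesis
  proof (cases "s \<in> \<rat>")
    case True
    then obtain p q :: nat where pq: "q \<noteq> 0" "s = real p / real q" "coprime p q"
      using Rats_abs_nat_div_natE[of s] s by (metis abs_of_pos)
    have q2: "q \<ge> 2"
    proof (rule ccontr)
      assume "\<not> q \<ge> 2" then have "q = 1" using pq by linarith
      then show False using s pq by simp
    qed
    have "p \<noteq> 0" using s(1) pq(2) by (cases p) auto
    then obtain k m where km': "p * k = q * m + 1"
      using bezout_nat[of p q] pq(3) by (auto simp: coprime_iff_gcd_eq_1)
    have "real k * s = real (p * k) / q" by (simp add: pq(2))
    also have "\<dots> = real m + 1 / q" unfolding km' using pq(1) by (simp add: field_simps)
    finally have kp: "real k * s = real m + 1 / q" .
    have "frac (real k * s) = 1 / q"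
      using q2 by (simp add: kp frac_unique_iff) 
    then show ?thesis using fr[of k] q2 that[of q] by simp
  next
    case False
    have "pi \<in> closure T"
      unfolding closure_approachable
    proof (intro allI impI)
      fix e :: real assume "e > 0"
      then obtain k where "\<bar>frac (real k * s) - 1/2\<bar> < e / (2 * pi)"
        using Kronecker_approx_1_explicit[OF False, of "1/2" "e / (2*pi)"] by (auto simp: )
      then have "\<bar>2 * pi * frac (real k * s) - pi\<bar> < e"
        by (auto simp: abs_less_iff field_simps)
      then show "\<exists>y\<in>T. dist y pi < e" using fr[of k] by (auto simp: dist_real_def)
    qed
    then show ?thesis using that[of 2] assms(1) by simp
  qed
qed

lemma closed_cover_interior:
  fixes C :: "'i::countable \<Rightarrow> 'a::{real_normed_vector,heine_borel} set"
  assumes "\<And>i. closed (C i)" "(\<Union>i. C i) = UNIV"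
  obtains i where "interior (C i) \<noteq> {}"
proof (rule ccontr)
  assume "\<not> thesis"
  then have "interior (C i) = {}" for i using that by blast
  then have "UNIV \<subseteq> closure (\<Inter> (range (\<lambda>i. - C i)))"
    by (intro Baire) (auto simp: assms closure_complement)
  moreover have "\<Inter> (range (\<lambda>i. - C i)) = {}" using assms(2) by auto
  ultimately show False by simp
qed

text \<open>If f x = X cos x - Y sin x were constant near m, then f(m+h) + f(m-h) = 2 f(m) cos h
  would force f(m) = 0, and f(m-h) = f(m+h) would force f'(m) = 0. Together these give X =
  0.\<close>

lemma sinusoid_not_locally_constant:
  fixes X Y s t :: real
  assumes "X > 0" "s < t"
  shows "\<exists>x\<in>{s..t}. X * cos x - Y * sin x \<noteq> X * cos s - Y * sin s"
proof (rule ccontr)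
  assume neg: "\<not> ?thesis"
  define p where "p = X * cos s - Y * sin s"
  have c: "X * cos x - Y * sin x = p" if "x \<in> {s..t}" for x
    using neg that unfolding p_def by blast
  define m h where "m = (s + t) / 2" and "h = min 1 ((t - s) / 2)"
  have h: "0 < h" "h < pi" using assms pi_gt3 by (auto simp: h_def)
  have in1: "m \<in> {s..t}" "m + h \<in> {s..t}" "m - h \<in> {s..t}"
    using assms by (auto simp: m_def h_def min_def field_simps)
  have sn: "sin h \<noteq> 0" using h sin_gt_zero by fastforce
  have "cos h \<noteq> 1" using sn sin_cos_squared_add[of h]
    by (metis add_cancel_left_left power_one zero_eq_power2)
  moreover have "2 * p = 2 * p * cos h"
  proof -
    have "2 * p = (X * cos (m+h) - Y * sin (m+h)) + (X * cos (m-h) - Y * sin (m-h))"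
      using c[OF in1(2)] c[OF in1(3)] by simp
    also have "\<dots> = 2 * (X * cos m - Y * sin m) * cos h"
      by (simp add: cos_add sin_add cos_diff sin_diff algebra_simps)
    finally show ?thesis using c[OF in1(1)] by simp
  qed
  ultimately have p0: "p = 0" by auto
  have "0 = (X * cos (m-h) - Y * sin (m-h)) - (X * cos (m+h) - Y * sin (m+h))"
    using c[OF in1(2)] c[OF in1(3)] by simp
  also have "\<dots> = 2 * sin h * (X * sin m + Y * cos m)"
    by (simp add: cos_add sin_add cos_diff sin_diff algebra_simps)
  finally have 1: "X * sin m + Y * cos m = 0" using sn by simp
  have 2: "X * cos m - Y * sin m = 0" using c[OF in1(1)] p0 by simp
  have "X = (X * sin m + Y * cos m) * sin m + (X * cos m - Y * sin m) * cos m"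
    using sin_cos_squared_add[of m] by algebra
  then show False using 1 2 assms by simp
qed


subsection \<open>Patches on a sphere\<close>

text \<open>\<open>H\<close> is the height along \<open>a\<close> and \<open>Z\<close> the horizontal part, identified with a complex number
  through \<open>b \<mapsto> 1\<close>, \<open>c \<mapsto> \<i>\<close>.\<close>

lemma cylinder_patch:
  fixes V :: "(real ^ 3) set" and H :: "real \<Rightarrow> real" and Z :: "real \<Rightarrow> complex"
  assumes fr: "frame a b c" and D: "D > 0" and \<epsilon>: "\<epsilon> > 0"
    and cH: "continuous_on UNIV H" and cZ: "continuous_on UNIV Z"
    and nrm: "\<And>\<psi>. (H \<psi>)\<^sup>2 + (cmod (Z \<psi>))\<^sup>2 = D\<^sup>2"
    and nonconst: "\<And>s t. s < t \<Longrightarrow> \<exists>x\<in>{s..t}. H x \<noteq> H s"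
    and V: "\<And>\<phi> \<psi>. \<bar>\<phi> - \<phi>0\<bar> < \<epsilon> \<Longrightarrow> \<bar>\<psi> - \<psi>0\<bar> < \<epsilon> \<Longrightarrow>
       H \<psi> *\<^sub>R a + Re (Z \<psi> * cis \<phi>) *\<^sub>R b + Im (Z \<psi> * cis \<phi>) *\<^sub>R c \<in> V"
  obtains W where "open W" "W \<inter> sphere 0 D \<noteq> {}" "W \<inter> sphere 0 D \<subseteq> V"
proof -
  have between: "\<exists>x. s \<le> x \<and> x \<le> t \<and> H x = h" if "s \<le> t" "min (H s) (H t) \<le> h" "h \<le> max (H s) (H t)" for s t h
    using that IVT'[of H s h t] IVT2'[of H t h s] continuous_on_subset[OF cH, of "{s..t}"]
    by (cases "H s \<le> H t") (auto simp: min_def max_def)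
  have Hle: "\<bar>H \<psi>\<bar> \<le> D" for \<psi>
    using nrm[of \<psi>] D by (intro abs_le_square_iff[THEN iffD2, of _ D, simplified abs_of_pos[OF D]]) 
      (smt (verit) zero_le_power2)
  have ZD: "Z \<psi> \<noteq> 0" if "\<bar>H \<psi>\<bar> < D" for \<psi>
  proof
    assume "Z \<psi> = 0"
    then have "\<bar>H \<psi>\<bar> = D" using nrm[of \<psi>] D by (metis abs_of_pos add.right_neutral norm_zero power2_eq_iff abs_minus zero_power2)
    then show False using that by simp
  qed
  \<comment> \<open>The poles, where \<open>Z\<close> vanishes and has no direction, must be
    avoided. The mean of two distinct values in [-D, D] lies strictly inside, and \<open>H\<close>
    attains it.\<close>
  obtain \<psi>1 where \<psi>1: "\<bar>\<psi>1 - \<psi>0\<bar> < \<epsilon>" "\<bar>H \<psi>1\<bar> < D"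
  proof -
    obtain x where x: "x \<in> {\<psi>0..\<psi>0 + \<epsilon>/2}" "H x \<noteq> H \<psi>0" using nonconst[of \<psi>0 "\<psi>0 + \<epsilon>/2"] \<epsilon> by auto
    obtain y where "\<psi>0 \<le> y" "y \<le> x" "H y = (H x + H \<psi>0) / 2"
      using between[of \<psi>0 x "(H x + H \<psi>0) / 2"] x by (cases "H x \<le> H \<psi>0") (auto simp: field_simps)
    then show ?thesis using that[of y] x \<epsilon> Hle[of x] Hle[of \<psi>0] by (auto simp: abs_if split: if_splits)
  qed
  define Z1 where "Z1 = Z \<psi>1"
  have Z1: "Z1 \<noteq> 0" using ZD \<psi>1 by (simp add: Z1_def)
  \<comment> \<open>A sector around the positive real axis, so membership depends on the direction
    only. The half-plane condition keeps \<open>Ln\<close> away from its branch cut.\<close>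
  define S where "S e = {z. Re z > 0 \<and> \<bar>Im (Ln z)\<bar> < e}" for e
  have S: "open (S e)" for e
  proof -
    have "open ({z. Re z > 0} \<inter> (\<lambda>z. \<bar>Im (Ln z)\<bar>) -` {..<e})"
      by (intro continuous_open_preimage continuous_intros open_halfspace_Re_gt)
         (auto simp: complex_nonpos_Reals_iff)
    also have "{z. Re z > 0} \<inter> (\<lambda>z. \<bar>Im (Ln z)\<bar>) -` {..<e} = S e" by (auto simp: S_def)
    finally show ?thesis .
  qed
  have S1: "of_real x \<in> S e" if "e > 0" "x > 0" for e x
    using that by (simp add: S_def Ln_of_real)
  have "\<exists>\<delta>>0. \<forall>\<psi>. \<bar>\<psi> - \<psi>1\<bar> < \<delta> \<longrightarrow> Z \<psi> / Z1 \<in> S (\<epsilon>/2)"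
  proof -
    have "continuous_on UNIV (\<lambda>\<psi>. Z \<psi> / Z1)" using Z1 by (intro continuous_intros cZ) auto
    then have "open ((\<lambda>\<psi>. Z \<psi> / Z1) -` S (\<epsilon>/2))" using S open_vimage by blast
    moreover have "\<psi>1 \<in> (\<lambda>\<psi>. Z \<psi> / Z1) -` S (\<epsilon>/2)"
      using Z1 S1[of "\<epsilon>/2" 1] \<epsilon> by (simp add: Z1_def)
    ultimately show ?thesis unfolding open_dist by (auto simp: dist_real_def)
  qed
  then obtain \<delta> where \<delta>: "\<delta> > 0" "\<And>\<psi>. \<bar>\<psi> - \<psi>1\<bar> < \<delta> \<Longrightarrow> Z \<psi> / Z1 \<in> S (\<epsilon>/2)" by blast
  define \<eta> where "\<eta> = min \<delta> (\<epsilon> - \<bar>\<psi>1 - \<psi>0\<bar>) / 2"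
  have \<eta>: "\<eta> > 0" "\<eta> < \<delta>" "\<bar>\<psi>1 - \<psi>0\<bar> + \<eta> < \<epsilon>" using \<delta> \<psi>1 by (auto simp: \<eta>_def min_def field_simps)
  obtain \<psi>2 where \<psi>2: "\<psi>1 \<le> \<psi>2" "\<psi>2 \<le> \<psi>1 + \<eta>" "H \<psi>2 \<noteq> H \<psi>1"
    using nonconst[of \<psi>1 "\<psi>1 + \<eta>"] \<eta> by auto
  define h1 h2 where "h1 = min (H \<psi>1) (H \<psi>2)" and "h2 = max (H \<psi>1) (H \<psi>2)"
  have h12: "h1 < h2" using \<psi>2 by (auto simp: h1_def h2_def)
  have close: "\<exists>\<psi>. \<bar>\<psi> - \<psi>0\<bar> < \<epsilon> \<and> Z \<psi> / Z1 \<in> S (\<epsilon>/2) \<and> H \<psi> = h" if h: "h1 < h" "h < h2" for h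
  proof -
    obtain \<psi> where \<psi>: "\<psi>1 \<le> \<psi>" "\<psi> \<le> \<psi>2" "H \<psi> = h"
      using between[of \<psi>1 \<psi>2 h] h \<psi>2(1) less_imp_le unfolding h1_def h2_def by metis
    then have "\<bar>\<psi> - \<psi>1\<bar> \<le> \<eta>" using \<psi>2 by auto
    then show ?thesis using \<eta> \<delta>(2)[of \<psi>] \<psi> by (intro exI[of _ \<psi>]) auto
  qed
  \<comment> \<open>The horizontal part of \<open>y\<close>, turned so that the reference direction
    \<open>Z1 * cis \<phi>0\<close> becomes the positive real axis. \<open>W\<close> restricts only
    height and direction, which on the sphere determine the point.\<close>
  define \<zeta> where "\<zeta> y = Complex (y \<bullet> b) (y \<bullet> c) / (Z1 * cis \<phi>0)" for y
  define W where "W = {y. h1 < y \<bullet> a \<and> y \<bullet> a < h2 \<and> \<zeta> y \<in> S (\<epsilon>/2)}"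
  have "open W"
  proof -
    have c\<zeta>: "continuous_on UNIV \<zeta>" unfolding \<zeta>_def complex_eq using Z1 
      by (intro continuous_intros) auto
    have "open ({y. h1 < y \<bullet> a} \<inter> {y. y \<bullet> a < h2} \<inter> \<zeta> -` S (\<epsilon>/2))"
      by (intro open_Int open_vimage[OF S c\<zeta>] open_Collect_less continuous_intros)
    also have "{y. h1 < y \<bullet> a} \<inter> {y. y \<bullet> a < h2} \<inter> \<zeta> -` S (\<epsilon>/2) = W" by (auto simp: W_def)
    finally show ?thesis .
  qed
  moreover have "W \<inter> sphere 0 D \<noteq> {}"
  proof -
    define h where "h = (h1 + h2) / 2"
    have h: "h1 < h" "h < h2" using h12 by (auto simp: h_def)
    obtain \<psi> where \<psi>: "Z \<psi> / Z1 \<in> S (\<epsilon>/2)" "H \<psi> = h" using close[OF h] by blast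
    have Zn: "Z \<psi> \<noteq> 0" using \<psi>(1) by (auto simp: S_def)
    \<comment> \<open>Modulus taken from \<open>Z \<psi>\<close>, direction exactly the reference
      one: this puts \<open>y\<close> on the sphere and makes \<open>\<zeta> y\<close> a positive
      real.\<close>
    define z where "z = of_real (cmod (Z \<psi>) / cmod Z1) * (Z1 * cis \<phi>0)"
    define y where "y = h *\<^sub>R a + Re z *\<^sub>R b + Im z *\<^sub>R c"
    have cz: "cmod z = cmod (Z \<psi>)" using Z1 by (simp add: z_def norm_mult norm_divide)
    have ya: "y \<bullet> a = h" "y \<bullet> b = Re z" "y \<bullet> c = Im z" 
      unfolding y_def by (simp_all add: inner_simps frameD[OF fr])
    have "\<zeta> y = of_real (cmod (Z \<psi>) / cmod Z1)"
      unfolding \<zeta>_def ya complex_surj z_def using Z1 by simp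
    then have "\<zeta> y \<in> S (\<epsilon>/2)" using S1[of "\<epsilon>/2" "cmod (Z \<psi>) / cmod Z1"] Zn Z1 \<epsilon> by simp
    then have "y \<in> W" using h by (simp add: W_def ya)
    moreover have "(norm y)\<^sup>2 = D\<^sup>2"
      unfolding y_def norm_frame[OF fr] using nrm[of \<psi>] \<psi>(2) cz[symmetric] by (simp add: cmod_power2)
    then have "norm y = D" using D by (simp add: power2_eq_iff_nonneg)
    ultimately show ?thesis by auto
  qed
  moreover have "W \<inter> sphere 0 D \<subseteq> V"
  proof
    fix y assume "y \<in> W \<inter> sphere 0 D"
    then have y: "h1 < y \<bullet> a" "y \<bullet> a < h2" "\<zeta> y \<in> S (\<epsilon>/2)" "norm y = D" by (auto simp: W_def)
    obtain \<psi> where \<psi>: "\<bar>\<psi> - \<psi>0\<bar> < \<epsilon>" "Z \<psi> / Z1 \<in> S (\<epsilon>/2)" "H \<psi> = y \<bullet> a"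
      using close[OF y(1,2)] by blast
    define z where "z = Complex (y \<bullet> b) (y \<bullet> c)"
    have yex: "y = (y \<bullet> a) *\<^sub>R a + Re z *\<^sub>R b + Im z *\<^sub>R c" using frame_expand[OF fr, of y] by (simp add: z_def)
    have "D\<^sup>2 = (y \<bullet> a)\<^sup>2 + (cmod z)\<^sup>2"
      using norm_frame[OF fr, of "y \<bullet> a" "Re z" "Im z"] yex y(4) by (simp add: cmod_power2)
    then have "(cmod z)\<^sup>2 = (cmod (Z \<psi>))\<^sup>2" using nrm[of \<psi>] \<psi>(3) by simp
    then have cz: "cmod z = cmod (Z \<psi>)" by (simp add: power2_eq_iff_nonneg)
    have Zn: "Z \<psi> / Z1 \<noteq> 0" "\<zeta> y \<noteq> 0" using \<psi>(2) y(3) by (auto simp: S_def)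
    have polar: "w = of_real (cmod w) * cis (Im (Ln w))" if "w \<noteq> 0" for w
      using that by (metis Arg_eq Arg_eq_Im_Ln cis_conv_exp)
    \<comment> \<open>Equal heights on the sphere give equal moduli, so only an angle is missing.
      Both arguments are below \<epsilon>/2, hence this correction to \<open>\<phi>0\<close> is
      admissible.\<close>
    define \<alpha> where "\<alpha> = Im (Ln (\<zeta> y)) - Im (Ln (Z \<psi> / Z1))"
    have "\<bar>\<alpha>\<bar> < \<epsilon>" using \<psi>(2) y(3) by (auto simp: \<alpha>_def S_def)
    have "\<zeta> y = Z \<psi> / Z1 * cis \<alpha>"
    proof -
      have "cmod (\<zeta> y) = cmod (Z \<psi> / Z1)"
        unfolding \<zeta>_def z_def[symmetric] using cz by (simp add: norm_divide norm_mult)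
      then have "\<zeta> y = of_real (cmod (Z \<psi> / Z1)) * cis (Im (Ln (Z \<psi> / Z1)) + \<alpha>)"
        using polar[OF Zn(2)] by (simp add: \<alpha>_def)
      also have "\<dots> = of_real (cmod (Z \<psi> / Z1)) * cis (Im (Ln (Z \<psi> / Z1))) * cis \<alpha>"
        by (simp add: cis_mult mult.assoc)
      finally show ?thesis using polar[OF Zn(1)] by simp
    qed
    then have "z / (Z1 * cis \<phi>0) = Z \<psi> / Z1 * cis \<alpha>" by (simp add: \<zeta>_def z_def)
    then have "z = Z \<psi> * cis (\<phi>0 + \<alpha>)" using Z1 by (simp add: field_simps flip: cis_mult)
    then show "y \<in> V" using V[of "\<phi>0 + \<alpha>" \<psi>] \<open>\<bar>\<alpha>\<bar> < \<epsilon>\<close> \<psi>(1,3) yex by simp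
  qed
  ultimately show ?thesis using that by blast
qed


text \<open>\<open>r u\<close> plays the contact point and \<open>d w\<close> the vector from it to
  a point of the level set \<open>V\<close>. One rotation with fixed \<open>n\<close> sweeps only a
  circle about the starting direction as the plane varies; a second one supplies the missing
  parameter.\<close>

lemma invariant_set_patch:
  fixes V :: "(real ^ 3) set"
  assumes "closed V" "V \<subseteq> sphere 0 D" "V \<noteq> {}" and pos: "0 < r" "0 < d" "0 < D"
    and rd: "r\<^sup>2 + d\<^sup>2 = D\<^sup>2"
    and inv: "\<And>u w w'. frame u w w' \<Longrightarrow> r *\<^sub>R u + d *\<^sub>R w \<in> V \<Longrightarrow>
      \<exists>n::nat\<ge>2. r *\<^sub>R u + d *\<^sub>R (cos (2 * pi / n) *\<^sub>R w + sin (2 * pi / n) *\<^sub>R w') \<in> V"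
  obtains W where "open W" "W \<inter> sphere 0 D \<noteq> {}" "W \<inter> sphere 0 D \<subseteq> V"
proof -
  \<comment> \<open>Coordinates, in a frame with first vector \<open>A/D\<close>, of the point \<open>A\<close> rotated by \<open>2\<pi>/n\<close> about the
    centre of its section by a plane at distance \<open>r\<close> from the origin.\<close>
  define h X Y where "h n = (r\<^sup>2 + d\<^sup>2 * cos (2 * pi / real n)) / D"
    and "X n = r * d / D * (1 - cos (2 * pi / real n))"
    and "Y n = d * sin (2 * pi / real n)" for n :: nat
  have sphere: "(h n)\<^sup>2 + ((X n)\<^sup>2 + (Y n)\<^sup>2) = D\<^sup>2" for n
  proof -
    have "D\<^sup>2 * ((h n)\<^sup>2 + ((X n)\<^sup>2 + (Y n)\<^sup>2)) =
      (r\<^sup>2 + d\<^sup>2 * cos (2 * pi / real n))\<^sup>2 + ((r * d * (1 - cos (2 * pi / real n)))\<^sup>2 + (r\<^sup>2 + d\<^sup>2) * (d * sin (2 * pi / real n))\<^sup>2)"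
      using pos rd by (simp add: h_def X_def Y_def field_simps power_mult_distrib power_divide)
    also have "\<dots> = (r\<^sup>2 + d\<^sup>2) * (r\<^sup>2 + d\<^sup>2)"
      using sin_cos_squared_add[of "2 * pi / real n"] by algebra
    finally have "D\<^sup>2 * ((h n)\<^sup>2 + ((X n)\<^sup>2 + (Y n)\<^sup>2)) = D\<^sup>2 * D\<^sup>2" by (simp only: rd)
    then show ?thesis using pos by (simp only: mult_cancel_left) simp
  qed
  \<comment> \<open>Here \<open>n \<ge> 2\<close> matters: the rotation is not the identity and
    moves the point off the axis \<open>a\<close>.\<close>
  have Xpos: "X n > 0" if "n \<ge> 2" for n
  proof -
    have "cos (2 * pi / real n) < cos 0"
      using that pi_gt_zero by (intro cos_monotone_0_pi) (auto simp: field_simps)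
    then show ?thesis using pos by (simp add: X_def)
  qed
  have step: "\<exists>n\<ge>2. h n *\<^sub>R a + X n *\<^sub>R b + Y n *\<^sub>R c \<in> V" if fr: "frame a b c" and V: "D *\<^sub>R a \<in> V" for a b c
  proof -
    \<comment> \<open>The normal of a plane at distance \<open>r\<close> from the origin through
      \<open>D a\<close>, tilted from \<open>a\<close> towards \<open>b\<close>; \<open>w\<close>
      points from the foot of the perpendicular to \<open>D a\<close>.\<close>
    define u w where "u = (r/D) *\<^sub>R a + (d/D) *\<^sub>R b" and "w = (d/D) *\<^sub>R a - (r/D) *\<^sub>R b"
    have "frame u w c" unfolding u_def w_def using pos rd
      by (intro frame_rotate fr) (simp add: power_divide flip: add_divide_distrib)
    moreover have "r *\<^sub>R u + d *\<^sub>R w = D *\<^sub>R a"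
    proof -
      have "r *\<^sub>R u + d *\<^sub>R w = ((r\<^sup>2 + d\<^sup>2) / D) *\<^sub>R a"
        by (simp add: u_def w_def algebra_simps power2_eq_square add_divide_distrib)
      then show ?thesis using rd pos by (simp add: power2_eq_square)
    qed
    ultimately obtain n where n: "n \<ge> 2"
      "r *\<^sub>R u + d *\<^sub>R (cos (2 * pi / real n) *\<^sub>R w + sin (2 * pi / real n) *\<^sub>R c) \<in> V"
      using inv V by metis
    have "r *\<^sub>R u + d *\<^sub>R (cos (2 * pi / real n) *\<^sub>R w + sin (2 * pi / real n) *\<^sub>R c)
       = h n *\<^sub>R a + X n *\<^sub>R b + Y n *\<^sub>R c"
      by (simp add: u_def w_def h_def X_def Y_def algebra_simps power2_eq_square add_divide_distrib diff_divide_distrib)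
    then show ?thesis using n by auto
  qed
  obtain x0 where x0: "x0 \<in> V" using assms by blast
  have nx0: "norm x0 = D" using x0 assms(2) by auto
  define a where "a = x0 /\<^sub>R D"
  have "norm a = 1" using nx0 pos by (simp add: a_def)
  then obtain b c where fr: "frame a b c" using frame_exists by blast
  have aV: "D *\<^sub>R a \<in> V" using x0 pos by (simp add: a_def)
  define q where "q n = sqrt ((X n)\<^sup>2 + (Y n)\<^sup>2)" for n
  have qpos: "q n > 0" if "n \<ge> 2" for n
    using Xpos[OF that] by (simp add: q_def sum_power2_gt_zero_iff)
  have q2: "(q n)\<^sup>2 = (X n)\<^sup>2 + (Y n)\<^sup>2" for n by (simp add: q_def)
  define S T where "S m \<psi> = X m * cos \<psi> + Y m * sin \<psi>" and "T m \<psi> = X m * sin \<psi> - Y m * cos \<psi>" for m and \<psi> :: real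
  define H where "H n m \<psi> = h m * h n / D + q n / D * S m \<psi>" for n m \<psi>
  define Z where "Z n m \<psi> = Complex (X n / q n) (- Y n / q n) *
     Complex (h m * q n / D - h n / D * S m \<psi>) (T m \<psi>)" for n m \<psi>
  \<comment> \<open>The result of rotating \<open>D a\<close> by \<open>2\<pi>/n\<close> in the plane with parameter \<open>\<phi>\<close>, and then by \<open>2\<pi>/m\<close> in
    the plane with parameter \<open>\<psi>\<close>. The second frame turns along with \<open>\<phi>\<close>, so that \<open>\<phi>\<close> enters only
    through the factor \<open>cis \<phi>\<close>.\<close>
  define y where "y n m \<phi> \<psi> = H n m \<psi> *\<^sub>R a + Re (Z n m \<psi> * cis \<phi>) *\<^sub>R b + Im (Z n m \<psi> * cis \<phi>) *\<^sub>R c" for n m \<phi> \<psi>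
  have cover: "\<exists>n m. n \<ge> 2 \<and> m \<ge> 2 \<and> y n m \<phi> \<psi> \<in> V" for \<phi> \<psi>
  proof -
    \<comment> \<open>\<phi> selects the first plane through \<open>D a\<close>: its normal is
      tilted from \<open>a\<close> towards \<open>G\<close>.\<close>
    define G G' where "G = cos \<phi> *\<^sub>R b + sin \<phi> *\<^sub>R c" and "G' = sin \<phi> *\<^sub>R b - cos \<phi> *\<^sub>R c"
    have frG: "frame a G G'" unfolding G_def G'_def
      by (meson fr frame_rotate frame_swap sin_cos_squared_add2)
    obtain n where n: "n \<ge> 2" "h n *\<^sub>R a + X n *\<^sub>R G + Y n *\<^sub>R G' \<in> V" using step[OF frG aV] by blast
    note q = qpos[OF n(1)]
    \<comment> \<open>\<open>g\<close> is the horizontal direction of the point reached first, and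
      \<open>q n\<close> its distance from the axis \<open>a\<close>.\<close>
    define g g' where "g = (X n / q n) *\<^sub>R G + (Y n / q n) *\<^sub>R G'" and "g' = (Y n / q n) *\<^sub>R G - (X n / q n) *\<^sub>R G'"
    have "frame G G' a" using frG frame_swap by blast
    then have frg: "frame g g' a" unfolding g_def g'_def
      using Xpos[OF n(1)] q2[of n] by (intro frame_rotate) (simp_all add: power_divide flip: add_divide_distrib)
    \<comment> \<open>\<open>D a'\<close> is the point reached first; the frame \<open>a'\<close>,
      \<open>b'\<close>, \<open>g'\<close> serves for the second rotation.\<close>
    define a' b' where "a' = (h n / D) *\<^sub>R a + (q n / D) *\<^sub>R g" and "b' = (q n / D) *\<^sub>R a - (h n / D) *\<^sub>R g"
    have "frame a g g'" using frg frame_swap by blast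
    then have fr': "frame a' b' g'" unfolding a'_def b'_def
      using q2[of n] sphere[of n] pos by (intro frame_rotate) (simp_all add: power_divide flip: add_divide_distrib)
    have "D *\<^sub>R a' = h n *\<^sub>R a + X n *\<^sub>R G + Y n *\<^sub>R G'"
      using pos q by (simp add: a'_def g_def algebra_simps)
    then have a'V: "D *\<^sub>R a' \<in> V" using n by simp
    define b'' c'' where "b'' = cos \<psi> *\<^sub>R b' + sin \<psi> *\<^sub>R g'" and "c'' = sin \<psi> *\<^sub>R b' - cos \<psi> *\<^sub>R g'"
    have "frame a' b'' c''" unfolding b''_def c''_def
      by (meson fr' frame_rotate frame_swap sin_cos_squared_add2)
    then obtain m where m: "m \<ge> 2" "h m *\<^sub>R a' + X m *\<^sub>R b'' + Y m *\<^sub>R c'' \<in> V" using step a'V by blast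
    have "h m *\<^sub>R a' + X m *\<^sub>R b'' + Y m *\<^sub>R c'' = h m *\<^sub>R a' + S m \<psi> *\<^sub>R b' + T m \<psi> *\<^sub>R g'"
      by (simp add: b''_def c''_def S_def T_def algebra_simps)
    also have "\<dots> = H n m \<psi> *\<^sub>R a + (h m * q n / D - h n / D * S m \<psi>) *\<^sub>R g + T m \<psi> *\<^sub>R g'"
      by (simp add: a'_def b'_def H_def algebra_simps)
    also have "\<dots> = y n m \<phi> \<psi>"
    proof -
      \<comment> \<open>In the complex coordinate, \<open>g\<close> is the unit number
        \<open>Complex (X n / q n) (- Y n / q n)\<close> times \<open>cis \<phi>\<close>, and
        \<open>g'\<close> is \<i> times that.\<close>
      have "A *\<^sub>R g + B *\<^sub>R g' = 
         Re (Complex (X n / q n) (- Y n / q n) * Complex A B * cis \<phi>) *\<^sub>R b +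
         Im (Complex (X n / q n) (- Y n / q n) * Complex A B * cis \<phi>) *\<^sub>R c" for A B
        by (simp add: g_def g'_def G_def G'_def algebra_simps)
      then show ?thesis by (simp add: y_def Z_def add.assoc)
    qed
    finally show ?thesis using n m by auto
  qed
  \<comment> \<open>Orders below 2 receive the empty set, so a nonempty interior also certifies
    \<open>n \<ge> 2\<close> and \<open>m \<ge> 2\<close>.\<close>
  define C where "C = (\<lambda>(n, m). if n \<ge> 2 \<and> m \<ge> 2 then {p. y n m (fst p) (snd p) \<in> V} else {})"
  have "closed (C i)" for i
  proof -
    have "closed {p. y n m (fst p) (snd p) \<in> V}" for n m
    proof -
      have "continuous_on UNIV (\<lambda>p. y n m (fst p) (snd p))"
        unfolding y_def H_def Z_def S_def T_def complex_eq cis_conv_exp by (intro continuous_intros)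
      then show ?thesis using closed_vimage[OF assms(1)] by (simp add: vimage_def)
    qed
    then show ?thesis by (auto simp: C_def split: prod.split)
  qed
  moreover have "(\<Union>i. C i) = UNIV"
  proof (intro equalityI subsetI UNIV_I)
    fix p :: "real \<times> real"
    show "p \<in> (\<Union>i. C i)" using cover[of "fst p" "snd p"] by (auto simp: C_def)
  qed
  ultimately obtain i where "interior (C i) \<noteq> {}" using closed_cover_interior by blast
  then obtain n m p0 where p0: "p0 \<in> interior (C (n, m))" by (metis equals0I surj_pair)
  then obtain e where e: "e > 0" "ball p0 e \<subseteq> C (n, m)" by (meson mem_interior)
  then have nm: "n \<ge> 2" "m \<ge> 2" using centre_in_ball[of p0 e] by (auto simp: C_def split: if_splits)
  show ?thesis
  proof (rule cylinder_patch[where H = "H n m" and Z = "Z n m" and V = V and ?\<phi>0.0 = "fst p0" and ?\<psi>0.0 = "snd p0" and \<epsilon> = "e/2", OF fr pos(3)])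
    show "0 < e / 2" using e by simp
    show "continuous_on UNIV (H n m)" "continuous_on UNIV (Z n m)"
      unfolding H_def Z_def S_def T_def complex_eq by (intro continuous_intros)+
    show "(H n m \<psi>)\<^sup>2 + (cmod (Z n m \<psi>))\<^sup>2 = D\<^sup>2" for \<psi>
    proof -
      have "cmod (Complex (X n / q n) (- Y n / q n)) = 1"
        using q2[of n] Xpos[OF nm(1)] by (simp add: cmod_def power_divide flip: add_divide_distrib)
      then have "(cmod (Z n m \<psi>))\<^sup>2 = (h m * q n / D - h n / D * S m \<psi>)\<^sup>2 + (T m \<psi>)\<^sup>2"
        by (simp add: Z_def norm_mult cmod_power2)
      then have "D\<^sup>2 * ((H n m \<psi>)\<^sup>2 + (cmod (Z n m \<psi>))\<^sup>2) =
         (h m * h n + q n * S m \<psi>)\<^sup>2 + (h m * q n - h n * S m \<psi>)\<^sup>2 + D\<^sup>2 * (T m \<psi>)\<^sup>2"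
      proof -
        have "H n m \<psi> = (h m * h n + q n * S m \<psi>) / D"
          "h m * q n / D - h n / D * S m \<psi> = (h m * q n - h n * S m \<psi>) / D"
          by (simp_all add: H_def add_divide_distrib diff_divide_distrib)
        moreover have "D\<^sup>2 * ((A / D)\<^sup>2 + ((B / D)\<^sup>2 + E)) = A\<^sup>2 + B\<^sup>2 + D\<^sup>2 * E" for A B E
          using pos by (simp add: power_divide distrib_left)
        ultimately show ?thesis using \<open>(cmod (Z n m \<psi>))\<^sup>2 = _\<close> by (simp only:)
      qed
      also have "\<dots> = ((h n)\<^sup>2 + (q n)\<^sup>2) * ((h m)\<^sup>2 + (S m \<psi>)\<^sup>2) + D\<^sup>2 * (T m \<psi>)\<^sup>2" by algebra
      also have "(h n)\<^sup>2 + (q n)\<^sup>2 = D\<^sup>2" using sphere q2 by simp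
      also have "D\<^sup>2 * ((h m)\<^sup>2 + (S m \<psi>)\<^sup>2) + D\<^sup>2 * (T m \<psi>)\<^sup>2 = D\<^sup>2 * ((h m)\<^sup>2 + ((S m \<psi>)\<^sup>2 + (T m \<psi>)\<^sup>2))"
        by algebra
      also have "(S m \<psi>)\<^sup>2 + (T m \<psi>)\<^sup>2 = (X m)\<^sup>2 + (Y m)\<^sup>2"
        unfolding S_def T_def using sin_cos_squared_add[of \<psi>] by algebra
      finally have "D\<^sup>2 * ((H n m \<psi>)\<^sup>2 + (cmod (Z n m \<psi>))\<^sup>2) = D\<^sup>2 * D\<^sup>2" by (simp only: sphere)
      then show ?thesis using pos by (simp only: mult_cancel_left) simp
    qed
    show "\<exists>x\<in>{s..t}. H n m x \<noteq> H n m s" if "s < t" for s t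
      \<comment> \<open>\<open>H n m\<close> is a constant plus the positive multiple
        \<open>q n / D\<close> of the sinusoid \<open>S m\<close>.\<close>
      using sinusoid_not_locally_constant[OF Xpos[OF nm(2)] that, of "- Y m"] qpos[OF nm(1)] pos
      by (auto simp: H_def S_def)
    show "H n m \<psi> *\<^sub>R a + Re (Z n m \<psi> * cis \<phi>) *\<^sub>R b + Im (Z n m \<psi> * cis \<phi>) *\<^sub>R c \<in> V"
      if "\<bar>\<phi> - fst p0\<bar> < e / 2" "\<bar>\<psi> - snd p0\<bar> < e / 2" for \<phi> \<psi>
    proof -
      have "dist (\<phi>, \<psi>) p0 \<le> \<bar>\<phi> - fst p0\<bar> + \<bar>\<psi> - snd p0\<bar>"
        unfolding dist_prod_def by (simp add: dist_real_def sqrt_sum_squares_le_sum_abs)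
      then have "(\<phi>, \<psi>) \<in> ball p0 e" using that by (simp add: dist_commute)
      then have "(\<phi>, \<psi>) \<in> C (n, m)" using e by blast
      then show ?thesis using nm by (simp add: C_def y_def)
    qed
  qed (use that in blast)
qed

subsection \<open>Sections of a convex body\<close>

lemma ray_interior_convex:
  fixes K :: "'a::euclidean_space set"
  assumes "convex K" "x \<in> interior K" "x + s *\<^sub>R v \<in> K" "0 \<le> e" "e < s"
  shows "x + e *\<^sub>R v \<in> interior K"
proof (cases "e = 0 \<or> v = 0")
  case False
  have "x + e *\<^sub>R v = (1 - e / s) *\<^sub>R x + (e / s) *\<^sub>R (x + s *\<^sub>R v)"
    using assms(4,5) by (simp add: algebra_simps)
  then have "x + e *\<^sub>R v \<in> open_segment x (x + s *\<^sub>R v)"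
    using assms(4,5) False by (auto simp: in_segment intro!: exI[of _ "e / s"])
  moreover have "open_segment x (x + s *\<^sub>R v) \<subseteq> interior K"
    using assms closure_subset by (intro in_interior_closure_convex_segment) auto
  ultimately show ?thesis by blast
qed (use assms in auto)

text \<open>The segment from \<open>p\<close> to a relative interior point \<open>x\<close> can be
  prolonged a little inside the section, so \<open>x\<close> lies strictly between an interior point
  of \<open>K\<close> and a point of \<open>K\<close>.\<close>

lemma interior_of_affine_section:
  fixes K :: "'a::euclidean_space set"
  assumes "convex K" "affine P" "p \<in> P" "p \<in> interior K"
    and x: "x \<in> top_of_set P interior_of (P \<inter> K)"
  shows "x \<in> interior K"
proof (cases "x = p")
  case False
  obtain T where T: "openin (top_of_set P) T" "x \<in> T" "T \<subseteq> P \<inter> K"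
    using x by (auto simp: interior_of_def)
  then obtain e where e: "e > 0" "ball x e \<inter> P \<subseteq> T"
    by (meson openin_contains_ball)
  define s where "s = e / (2 * norm (x - p))"
  have s: "s > 0" "s * norm (x - p) < e" using False e by (auto simp: s_def)
  define y where "y = p + (1 + s) *\<^sub>R (x - p)"
  have "y = (1 + s) *\<^sub>R x + (- s) *\<^sub>R p" by (simp add: y_def algebra_simps)
  then have "y \<in> P" using mem_affine[OF assms(2), of x p "1 + s" "- s"] T assms(3) by auto
  moreover have "dist x y < e"
  proof -
    have "x - y = - (s *\<^sub>R (x - p))" by (simp add: y_def algebra_simps)
    then show ?thesis using s by (simp add: dist_norm)
  qed
  ultimately have "y \<in> K" using e T by auto
  then show ?thesis
    using ray_interior_convex[OF assms(1,4), of "1 + s" "x - p" 1] s by (simp add: y_def)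
qed (use assms in simp)

lemma frontier_of_affine_section:
  fixes K :: "'a::euclidean_space set"
  assumes "closed K" "convex K" "affine P" "p \<in> P" "p \<in> interior K" "x \<in> P" "x \<in> frontier K"
  shows "x \<in> top_of_set P frontier_of (P \<inter> K)"
proof -
  have "x \<in> K" "x \<notin> interior K" using assms by (auto simp: frontier_def)
  moreover have "P \<inter> K \<subseteq> top_of_set P closure_of (P \<inter> K)"
    by (rule closure_of_subset) simp
  ultimately show ?thesis
    using interior_of_affine_section[OF assms(2-5)] assms(6) by (auto simp: frontier_of_def)
qed

lemma frontier_unique_on_ray:
  fixes K :: "'a::euclidean_space set"
  assumes "closed K" "convex K" "x \<in> interior K" "x + s *\<^sub>R v \<in> frontier K" "x + t *\<^sub>R v \<in> frontier K"
    "s \<ge> 0" "t \<ge> 0"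
  shows "s = t"
proof -
  have K: "x + s *\<^sub>R v \<in> K" "x + t *\<^sub>R v \<in> K" "x + s *\<^sub>R v \<notin> interior K" "x + t *\<^sub>R v \<notin> interior K"
    using assms by (auto simp: frontier_def)
  then show ?thesis
    using ray_interior_convex[OF assms(2,3) K(1) assms(7)] ray_interior_convex[OF assms(2,3) K(2) assms(6)]
    by force
qed

section \<open>Following tangent chords around the section\<close>

text \<open>A chord piece of length \<open>l\<close> before the contact point is followed by one of
  length \<open>k / l\<close> after it. By the right triangles at the contact point, both radii and
  the angle travelled depend on \<open>l\<close> alone.\<close>

lemma equipotential_chord_step:
  fixes K :: "'a::euclidean_space set"
  assumes K: "compact K" "convex K" and fr: "frame u w w'" and p: "p \<in> interior K"
    and P: "P = {x. (x - p) \<bullet> u = 0}" and "\<rho> > 0" and C: "P \<inter> sphere p \<rho> \<subseteq> interior K"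
    and k: "\<forall>L t a b. L \<subseteq> P \<and> tangent_line_at L (P \<inter> sphere p \<rho>) t \<and> is_chord P (P \<inter> K) L a b
              \<longrightarrow> dist a t * dist t b = k"
    and pt: "pt = (\<lambda>s t. p + s *\<^sub>R (cos t *\<^sub>R w + sin t *\<^sub>R w'))"
    and "l > 0" and A: "pt (sqrt (\<rho>\<^sup>2 + l\<^sup>2)) t \<in> frontier K"
  shows "k > 0 \<and> pt (sqrt (\<rho>\<^sup>2 + (k / l)\<^sup>2)) (t + arctan (l / \<rho>) + arctan (k / l / \<rho>)) \<in> frontier K"
proof -
  have aff: "affine P"
  proof -
    have "P = {x. u \<bullet> x = u \<bullet> p}" by (auto simp: P inner_simps inner_commute)
    then show ?thesis by (simp add: affine_hyperplane)
  qed
  have pP: "p \<in> P" by (simp add: P)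
  \<comment> \<open>The contact point is chosen ahead of the given boundary point, which then sits
    at signed distance \<open>- l\<close> along the tangent direction \<open>v\<close>.\<close>
  define \<tau> where "\<tau> = t + arctan (l / \<rho>)"
  define T where "T = pt \<rho> \<tau>"
  define v where "v = cos \<tau> *\<^sub>R w' - sin \<tau> *\<^sub>R w"
  \<comment> \<open>\<open>arctan (s / \<rho>)\<close> is the angle at \<open>p\<close> between \<open>T\<close> and the point of the tangent at signed distance \<open>s\<close>.\<close>
  have vpt: "T + s *\<^sub>R v = pt (sqrt (\<rho>\<^sup>2 + s\<^sup>2)) (\<tau> + arctan (s / \<rho>))" for s
  proof -
    have "sqrt (\<rho>\<^sup>2 + s\<^sup>2) = \<rho> * sqrt (1 + (s / \<rho>)\<^sup>2)"
    proof -
      have "\<rho>\<^sup>2 + s\<^sup>2 = \<rho>\<^sup>2 * (1 + (s / \<rho>)\<^sup>2)" using \<open>\<rho> > 0\<close> by (simp add: power_divide distrib_left)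
      then show ?thesis using \<open>\<rho> > 0\<close> by (simp add: real_sqrt_mult)
    qed
    moreover have "sqrt (1 + (s / \<rho>)\<^sup>2) > 0" by (simp add: add_pos_nonneg)
    ultimately have cs: "sqrt (\<rho>\<^sup>2 + s\<^sup>2) * cos (arctan (s / \<rho>)) = \<rho>" "sqrt (\<rho>\<^sup>2 + s\<^sup>2) * sin (arctan (s / \<rho>)) = s"
      using \<open>\<rho> > 0\<close> by (simp_all add: cos_arctan sin_arctan)
    have comb: "A * (y * ca - z * sa) = \<rho> * y - s * z" "A * (z * ca + y * sa) = \<rho> * z + s * y"
      if "A * ca = \<rho>" "A * sa = s" for A ca sa y z
    proof -
      have "A * (y * ca - z * sa) = (A * ca) * y - (A * sa) * z"
        "A * (z * ca + y * sa) = (A * ca) * z + (A * sa) * y"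
        by (simp_all add: algebra_simps)
      then show "A * (y * ca - z * sa) = \<rho> * y - s * z" "A * (z * ca + y * sa) = \<rho> * z + s * y"
        by (simp_all only: that)
    qed
    have 1: "sqrt (\<rho>\<^sup>2 + s\<^sup>2) * cos (\<tau> + arctan (s / \<rho>)) = \<rho> * cos \<tau> - s * sin \<tau>"
      "sqrt (\<rho>\<^sup>2 + s\<^sup>2) * sin (\<tau> + arctan (s / \<rho>)) = \<rho> * sin \<tau> + s * cos \<tau>"
      unfolding cos_add sin_add by (rule comb[OF cs])+
    show ?thesis unfolding pt T_def v_def scaleR_add_right scaleR_scaleR 1
      by (simp add: algebra_simps)
  qed
  have PT: "T + s *\<^sub>R v \<in> P" for s
    by (simp add: T_def v_def P pt inner_simps frameD[OF fr])
  have vv: "v \<bullet> v = 1" "(T - p) \<bullet> v = 0" "(T - p) \<bullet> (T - p) = \<rho>\<^sup>2"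
  proof -
    show "v \<bullet> v = 1" by (simp add: v_def inner_simps frameD[OF fr] flip: power2_eq_square)
    show "(T - p) \<bullet> v = 0" by (simp add: T_def pt v_def inner_simps frameD[OF fr])
    have "(T - p) \<bullet> (T - p) = \<rho>\<^sup>2 * ((cos \<tau>)\<^sup>2 + (sin \<tau>)\<^sup>2)" 
      by (simp add: T_def pt inner_simps frameD[OF fr] power2_eq_square algebra_simps
          del: sin_cos_squared_add sin_cos_squared_add2 sin_cos_squared_add3)
    then show "(T - p) \<bullet> (T - p) = \<rho>\<^sup>2" by simp
  qed
  have dT: "(dist p (T + s *\<^sub>R v))\<^sup>2 = \<rho>\<^sup>2 + s\<^sup>2" for s
  proof -
    have "dist p (T + s *\<^sub>R v) = norm ((T - p) + s *\<^sub>R v)"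
      by (subst dist_commute) (simp add: dist_norm algebra_simps)
    then have "(dist p (T + s *\<^sub>R v))\<^sup>2 = ((T - p) + s *\<^sub>R v) \<bullet> ((T - p) + s *\<^sub>R v)"
      by (simp only: power2_norm_eq_inner)
    also have "\<dots> = \<rho>\<^sup>2 + s\<^sup>2"
      unfolding inner_add_left inner_add_right inner_scaleR_left inner_scaleR_right
      using vv by (simp add: inner_commute power2_eq_square)
    finally show ?thesis .
  qed
  have v0: "v \<noteq> 0" using vv by auto
  have TC: "T \<in> P \<inter> sphere p \<rho>"
    using PT[of 0] dT[of 0] \<open>\<rho> > 0\<close> by (simp add: power2_eq_iff_nonneg)
  then have TK: "T \<in> interior K" using C by blast
  have Tl: "T + (- l) *\<^sub>R v \<in> frontier K"
    unfolding vpt using A by (simp add: \<tau>_def arctan_minus)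
  obtain b where b: "b > 0" "T + b *\<^sub>R v \<in> frontier K"
    using ray_to_frontier[OF compact_imp_bounded[OF K(1)] TK v0] by blast
  define L where "L = range (\<lambda>s. T + s *\<^sub>R v)"
  have L_hull: "L = affine hull {T, T + v}" by (simp add: L_def affine_hull_2_alt)
  have frK: "x \<in> K \<and> x \<notin> interior K" if "x \<in> frontier K" for x
    using that compact_imp_closed[OF K(1)] by (auto simp: frontier_def)
  have inL: "T + s *\<^sub>R v \<in> L" for s unfolding L_def by (rule rangeI)
  have "L \<subseteq> P" using PT by (auto simp: L_def)
  moreover have "tangent_line_at L (P \<inter> sphere p \<rho>) T"
    unfolding tangent_line_at_def is_line_def
  proof (intro conjI)
    show "affine L" "aff_dim L = 1" using v0 by (simp_all add: L_hull aff_dim_affine_hull)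
    have "s = 0" if "T + s *\<^sub>R v \<in> sphere p \<rho>" for s using dT[of s] that by simp
    then show "L \<inter> (P \<inter> sphere p \<rho>) = {T}" using TC by (auto simp: L_def image_iff intro: exI[of _ 0])
  qed
  moreover have "is_chord P (P \<inter> K) L (T + (- l) *\<^sub>R v) (T + b *\<^sub>R v)"
    unfolding is_chord_def
  proof (intro conjI)
    show "T + (- l) *\<^sub>R v \<in> top_of_set P frontier_of (P \<inter> K)" "T + b *\<^sub>R v \<in> top_of_set P frontier_of (P \<inter> K)"
      using frontier_of_affine_section[OF compact_imp_closed[OF K(1)] K(2) aff pP p PT] Tl b by blast+
    show "L \<inter> (P \<inter> K) = closed_segment (T + (- l) *\<^sub>R v) (T + b *\<^sub>R v)"
    proof
      have "convex (L \<inter> (P \<inter> K))" unfolding L_hull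
        by (intro convex_Int affine_imp_convex affine_affine_hull aff K)
      then show "closed_segment (T + (- l) *\<^sub>R v) (T + b *\<^sub>R v) \<subseteq> L \<inter> (P \<inter> K)"
        using inL PT frK[OF Tl] frK[OF b(2)] by (intro closed_segment_subset) blast+
      show "L \<inter> (P \<inter> K) \<subseteq> closed_segment (T + (- l) *\<^sub>R v) (T + b *\<^sub>R v)"
      proof
        fix x assume "x \<in> L \<inter> (P \<inter> K)"
        then obtain s where s: "x = T + s *\<^sub>R v" "T + s *\<^sub>R v \<in> K" by (auto simp: L_def)
        have "s \<le> b" using ray_interior_convex[OF K(2) TK s(2), of b] b frK[OF b(2)] by force
        moreover have "- l \<le> s"
          using ray_interior_convex[OF K(2) TK, of "- s" "- v" l] s(2) \<open>l > 0\<close> frK[OF Tl] by force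
        moreover have "x = (1 - (s + l) / (b + l)) *\<^sub>R (T + (- l) *\<^sub>R v) + ((s + l) / (b + l)) *\<^sub>R (T + b *\<^sub>R v)"
        proof -
          have "(1 - \<mu>) *\<^sub>R (T + (- l) *\<^sub>R v) + \<mu> *\<^sub>R (T + b *\<^sub>R v) = T + (\<mu> * (b + l) - l) *\<^sub>R v" for \<mu>
            by (simp add: algebra_simps)
          then show ?thesis using b \<open>l > 0\<close> s(1) by simp
        qed
        ultimately show "x \<in> closed_segment (T + (- l) *\<^sub>R v) (T + b *\<^sub>R v)"
          using b \<open>l > 0\<close> unfolding closed_segment_def
          by (intro CollectI exI[of _ "(s + l) / (b + l)"]) auto
      qed
    qed
  qed
  ultimately have "dist (T + (- l) *\<^sub>R v) T * dist T (T + b *\<^sub>R v) = k" using k by blast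
  moreover have "norm v = 1" using vv by (simp add: norm_eq_1)
  ultimately have lb: "l * b = k" using b \<open>l > 0\<close> by (simp add: dist_norm)
  then have "b = k / l" "k > 0" using \<open>l > 0\<close> b by auto
  then show ?thesis using b(2) vpt[of b] by (simp add: \<tau>_def)
qed

text \<open>Two chord steps exchange \<open>l\<close> with \<open>k / l\<close> and back, so the
  distance from \<open>p\<close> returns to \<open>d\<close> while the angle grows by twice a sum of
  two arctangents of positive numbers, which is strictly between 0 and
  \<open>2 * pi\<close>.\<close>

lemma equipotential_level_invariant:
  fixes K :: "'a::euclidean_space set"
  assumes K: "compact K" "convex K" and dim: "DIM('a) = 3" and "r > 0" and cK: "cball c r \<subseteq> interior K"
    and equi: "\<And>P p. tangent_plane_at P (cball c r) p \<Longrightarrow> \<exists>C. equipotential_circle P (P \<inter> K) p C"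
    and fr: "frame u w w'" and "d > 0" and A: "c + (r *\<^sub>R u + d *\<^sub>R w) \<in> frontier K"
  shows "\<exists>n::nat\<ge>2. c + (r *\<^sub>R u + d *\<^sub>R (cos (2 * pi / n) *\<^sub>R w + sin (2 * pi / n) *\<^sub>R w')) \<in> frontier K"
proof -
  define p where "p = c + r *\<^sub>R u"
  define P where "P = {x. (x - p) \<bullet> u = 0}"
  have nu: "norm u = 1" "u \<noteq> 0" using frameD[OF fr] by (auto simp: norm_eq_1)
  have Phyp: "P = {x. u \<bullet> x = u \<bullet> p}" by (auto simp: P_def inner_simps inner_commute)
  have "tangent_plane_at P (cball c r) p"
    unfolding tangent_plane_at_def is_plane_def
  proof (intro conjI)
    show aff: "affine P" by (simp add: Phyp affine_hyperplane)
    show "aff_dim P = 2" using nu dim by (simp add: Phyp aff_dim_hyperplane)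
    show "P \<inter> cball c r = {p}"
    proof
      show "{p} \<subseteq> P \<inter> cball c r" using nu \<open>r > 0\<close> by (simp add: P_def p_def dist_norm)
      show "P \<inter> cball c r \<subseteq> {p}"
      proof
        fix x assume x: "x \<in> P \<inter> cball c r"
        \<comment> \<open>With this value the squared distance of \<open>x\<close> from
          \<open>p\<close> is that from \<open>c\<close> minus the square of \<open>r\<close>, hence
          not positive.\<close>
        have "(x - c) \<bullet> u = r" using x frameD[OF fr] by (simp add: P_def p_def inner_simps algebra_simps)
        moreover have "(norm (x - c))\<^sup>2 \<le> r\<^sup>2" using x by (intro power_mono) (auto simp: dist_norm norm_minus_commute)
        moreover have "(norm (x - p))\<^sup>2 = (norm (x - c))\<^sup>2 - 2 * r * ((x - c) \<bullet> u) + r\<^sup>2"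
        proof -
          have "(norm (z - r *\<^sub>R u))\<^sup>2 = (norm z)\<^sup>2 - 2 * r * (z \<bullet> u) + r\<^sup>2" for z
            unfolding power2_norm_eq_inner inner_diff_left inner_diff_right inner_scaleR_left
              inner_scaleR_right inner_commute[of u z] frameD(1)[OF fr]
            by (simp add: power2_eq_square algebra_simps)
          from this[of "x - c"] show ?thesis by (simp add: p_def diff_diff_eq)
        qed
        ultimately have "(norm (x - p))\<^sup>2 \<le> 0" by (simp add: power2_eq_square)
        then show "x \<in> {p}" by simp
      qed
    qed
  qed
  then obtain C where C: "equipotential_circle P (P \<inter> K) p C"
    using equi by blast
  then obtain \<rho> where plane: "is_plane P" and pP: "p \<in> P" and \<rho>: "\<rho> > 0" and C_eq: "C = P \<inter> sphere p \<rho>"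
    unfolding equipotential_circle_def circle_in_plane_def by blast
  have int: "P \<inter> sphere p \<rho> \<subseteq> top_of_set P interior_of (P \<inter> K)"
    using C unfolding equipotential_circle_def C_eq by blast
  obtain k where k: "\<forall>L t a b. L \<subseteq> P \<and> tangent_line_at L (P \<inter> sphere p \<rho>) t \<and> is_chord P (P \<inter> K) L a b
      \<longrightarrow> dist a t * dist t b = k"
    using C unfolding equipotential_circle_def C_eq by (elim conjE exE)
  have aff: "affine P" using plane by (simp add: is_plane_def)
  have pK: "p \<in> interior K" using cK nu \<open>r > 0\<close> by (auto simp: p_def dist_norm subset_iff)
  have sph: "P \<inter> sphere p \<rho> \<subseteq> interior K"
    using interior_of_affine_section[OF K(2) aff pP pK] int by blast
  define pt where "pt = (\<lambda>s t. p + s *\<^sub>R (cos t *\<^sub>R w + sin t *\<^sub>R w'))"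
  note step = equipotential_chord_step[OF K fr pK P_def \<rho> sph k pt_def]
  have A0: "pt d 0 \<in> frontier K" using A by (simp add: pt_def p_def add.assoc)
  \<comment> \<open>The circle lies in the interior, so boundary points in the plane are farther
    from \<open>p\<close> than it is; this makes the tangent length \<open>l\<close> real and
    positive.\<close>
  have "\<rho> < d"
  proof (rule ccontr)
    assume "\<not> \<rho> < d"
    have "norm w = 1" using frameD[OF fr] by (simp add: norm_eq_1)
    then have "p + \<rho> *\<^sub>R w \<in> P \<inter> sphere p \<rho>" using \<rho>
      by (simp add: P_def frameD[OF fr] dist_norm)
    then have \<rho>K: "p + \<rho> *\<^sub>R w \<in> interior K" using sph by blast
    have "p + d *\<^sub>R w \<in> interior K"
      using ray_interior_convex[OF K(2) pK, of \<rho> w d] \<rho>K interior_subset \<open>d > 0\<close> \<open>\<not> \<rho> < d\<close>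
      by (cases "d = \<rho>") auto
    then show False using A0 by (simp add: pt_def frontier_def)
  qed
  define l where "l = sqrt (d\<^sup>2 - \<rho>\<^sup>2)"
  have "\<rho>\<^sup>2 < d\<^sup>2" using \<open>\<rho> < d\<close> \<rho> by (simp add: power_strict_mono)
  then have l: "l > 0" "sqrt (\<rho>\<^sup>2 + l\<^sup>2) = d" using \<open>d > 0\<close> by (simp_all add: l_def)
  have k0: "k > 0" using step[OF l(1), of 0] A0 l by simp
  define \<theta> where "\<theta> = 2 * (arctan (l / \<rho>) + arctan (k / l / \<rho>))"
  have rot: "pt d (t + \<theta>) \<in> frontier K" if "pt d t \<in> frontier K" for t
  proof -
    have "pt (sqrt (\<rho>\<^sup>2 + (k / l)\<^sup>2)) (t + arctan (l / \<rho>) + arctan (k / l / \<rho>)) \<in> frontier K"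
      using step[OF l(1), of t] that l by simp
    moreover have "k / l > 0" using k0 l by simp
    ultimately have "pt (sqrt (\<rho>\<^sup>2 + (k / (k / l))\<^sup>2))
       (t + arctan (l / \<rho>) + arctan (k / l / \<rho>) + arctan (k / l / \<rho>) + arctan (k / (k / l) / \<rho>)) \<in> frontier K"
      using step by blast
    moreover have "k / (k / l) = l" using k0 by simp
    ultimately show ?thesis using l by (simp add: \<theta>_def algebra_simps)
  qed
  define T where "T = {t. pt d t \<in> frontier K}"
  have "closed T"
  proof -
    have "continuous_on UNIV (pt d)" unfolding pt_def by (intro continuous_intros)
    then show ?thesis using closed_vimage[OF frontier_closed] by (auto simp: T_def vimage_def)
  qed
  moreover have "0 \<in> T" using A0 by (simp add: T_def)
  moreover have "0 < \<theta>" "\<theta> < 2 * pi"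
  proof -
    define \<alpha> \<beta> where "\<alpha> = arctan (l / \<rho>)" and "\<beta> = arctan (k / l / \<rho>)"
    have "0 < \<alpha>" "0 < \<beta>" "\<alpha> < pi / 2" "\<beta> < pi / 2"
      using l \<rho> k0 arctan_ubound by (simp_all add: \<alpha>_def \<beta>_def)
    moreover have "\<theta> = 2 * (\<alpha> + \<beta>)" by (simp add: \<theta>_def \<alpha>_def \<beta>_def)
    ultimately show "0 < \<theta>" "\<theta> < 2 * pi" by simp_all
  qed
  moreover have "t - 2 * pi \<in> T" if "t \<in> T" for t using that by (simp add: T_def pt_def sin_diff cos_diff)
  moreover have "t + \<theta> \<in> T" if "t \<in> T" for t using that rot by (simp add: T_def)
  ultimately obtain n where "n \<ge> 2" "2 * pi / real n \<in> T"
    using rotation_closed_set_contains_fraction by blast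
  then show ?thesis by (auto simp: T_def pt_def p_def add.assoc intro!: exI[of _ n])
qed

section \<open>From patches on every level to a single level\<close>

theorem theorem5:
  fixes K :: "(real ^ 3) set" and c :: "real ^ 3" and r :: real
  assumes "convex_body K"
    and "r > 0"
    and "cball c r \<subseteq> interior K"
    and "\<And>P p. tangent_plane_at P (cball c r) p \<Longrightarrow>
           \<exists>C. equipotential_circle P (P \<inter> K) p C"
  shows "\<exists>a R. R > 0 \<and> K = cball a R"
proof -
  have K: "compact K" "convex K" using assms(1) by (auto simp: convex_body_def)
  note clK = compact_imp_closed[OF K(1)]
  have cint: "c \<in> interior K" using assms(2,3) by auto
  define f where "f x = norm (x - c)" for x
  have frr: "f x > r" if "x \<in> frontier K" for x
    using that assms(3) by (force simp: frontier_def f_def dist_norm norm_minus_commute)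
  \<comment> \<open>The patch is replaced by the open cone over it with apex \<open>c\<close>:
    patches are open only in their spheres, while disjoint open sets in space can be
    counted.\<close>
  have patch: "\<exists>U. open U \<and> U \<noteq> {} \<and> (\<forall>z\<in>U. z \<noteq> 0 \<and> c + (D / norm z) *\<^sub>R z \<in> frontier K)"
    if Df: "D \<in> f ` frontier K" for D
  proof -
    obtain x where x: "x \<in> frontier K" "D = f x" using Df by auto
    have D: "D > r" "D > 0" using frr x assms(2) by force+
    define V where "V = (\<lambda>x. c + x) -` frontier K \<inter> sphere 0 D"
    have "D\<^sup>2 > r\<^sup>2" using D assms(2) by (simp add: power_strict_mono)
    define d where "d = sqrt (D\<^sup>2 - r\<^sup>2)"
    have d: "d > 0" "r\<^sup>2 + d\<^sup>2 = D\<^sup>2" using \<open>D\<^sup>2 > r\<^sup>2\<close> by (auto simp: d_def)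
    obtain W where W: "open W" "W \<inter> sphere 0 D \<noteq> {}" "W \<inter> sphere 0 D \<subseteq> V"
    proof (rule invariant_set_patch[of V D r d])
      show "closed V" unfolding V_def
        by (intro closed_Int closed_vimage frontier_closed continuous_intros closed_sphere)
      have "x - c \<in> V" using x by (simp add: V_def f_def)
      then show "V \<noteq> {}" by blast
      show "\<exists>n::nat\<ge>2. r *\<^sub>R u + d *\<^sub>R (cos (2 * pi / n) *\<^sub>R w + sin (2 * pi / n) *\<^sub>R w') \<in> V"
        if fr: "frame u w w'" and V: "r *\<^sub>R u + d *\<^sub>R w \<in> V" for u w w'
      proof -
        have "norm (r *\<^sub>R u + d *\<^sub>R (cos t *\<^sub>R w + sin t *\<^sub>R w')) = D" for t
        proof -
          have "(norm (r *\<^sub>R u + (d * cos t) *\<^sub>R w + (d * sin t) *\<^sub>R w'))\<^sup>2 = r\<^sup>2 + d\<^sup>2 * ((cos t)\<^sup>2 + (sin t)\<^sup>2)"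
            unfolding norm_frame[OF fr] by (simp add: power_mult_distrib distrib_left del: sin_cos_squared_add sin_cos_squared_add2)
          then have "(norm (r *\<^sub>R u + (d * cos t) *\<^sub>R w + (d * sin t) *\<^sub>R w'))\<^sup>2 = D\<^sup>2" using d by simp
          then show ?thesis using D by (simp add: power2_eq_iff_nonneg algebra_simps)
        qed
        moreover have "c + (r *\<^sub>R u + d *\<^sub>R w) \<in> frontier K" using V by (simp add: V_def)
        ultimately show ?thesis
          using equipotential_level_invariant[OF K _ assms(2,3,4) fr d(1)] by (auto simp: V_def)
      qed
    qed (use D d assms(2) in \<open>auto simp: V_def\<close>)
    define U where "U = {z. z \<noteq> 0} \<inter> (\<lambda>z. (D / norm z) *\<^sub>R z) -` W"
    have "open U" unfolding U_def
      by (intro continuous_open_preimage W continuous_intros open_Collect_neq) auto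
    moreover have "U \<noteq> {}"
    proof -
      obtain y where "y \<in> W \<inter> sphere 0 D" using W(2) by blast
      then have "y \<in> U" using D by (auto simp: U_def)
      then show ?thesis by blast
    qed
    moreover have "z \<noteq> 0 \<and> c + (D / norm z) *\<^sub>R z \<in> frontier K" if "z \<in> U" for z
    proof -
      have z: "z \<noteq> 0" "(D / norm z) *\<^sub>R z \<in> W" using that by (auto simp: U_def)
      then have "(D / norm z) *\<^sub>R z \<in> V" using W D by auto
      then show ?thesis using z by (simp add: V_def)
    qed
    ultimately show ?thesis by blast
  qed
  then obtain U where U: "\<And>D. D \<in> f ` frontier K \<Longrightarrow> open (U D) \<and> U D \<noteq> {} \<and>
     (\<forall>z\<in>U D. z \<noteq> 0 \<and> c + (D / norm z) *\<^sub>R z \<in> frontier K)"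
    by metis
  \<comment> \<open>A common direction of two cones would give two boundary points on one ray from
    the interior point \<open>c\<close>.\<close>
  have disj: "D = D'" if "D \<in> f ` frontier K" "D' \<in> f ` frontier K" "z \<in> U D" "z \<in> U D'" for D D' z
  proof -
    have z: "z \<noteq> 0" "c + (D / norm z) *\<^sub>R z \<in> frontier K" "c + (D' / norm z) *\<^sub>R z \<in> frontier K"
      using U that by blast+
    moreover have "D \<ge> 0" "D' \<ge> 0" using that(1,2) by (auto simp: f_def)
    ultimately have "D / norm z = D' / norm z"
      by (intro frontier_unique_on_ray[OF clK K(2) cint z(2,3)]) auto
    then show ?thesis using z(1) by simp
  qed
  have "countable (U ` f ` frontier K)"
  proof (rule countable_disjoint_open_subsets)
    show "pairwise disjnt (U ` f ` frontier K)"
    proof (rule pairwiseI)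
      fix A B assume "A \<in> U ` f ` frontier K" "B \<in> U ` f ` frontier K" "A \<noteq> B"
      then obtain D D' where D: "D \<in> f ` frontier K" "D' \<in> f ` frontier K" "A = U D" "B = U D'"
        by blast
      then have "D \<noteq> D'" using \<open>A \<noteq> B\<close> by blast
      then show "disjnt A B" using disj[OF D(1,2)] D(3,4) by (auto simp: disjnt_iff)
    qed
  qed (use U in auto)
  moreover have "inj_on U (f ` frontier K)"
  proof (rule inj_onI)
    fix D D' assume D: "D \<in> f ` frontier K" "D' \<in> f ` frontier K" "U D = U D'"
    obtain z where "z \<in> U D" using U[OF D(1)] by blast
    then show "D = D'" using disj[OF D(1,2)] D(3) by blast
  qed
  ultimately have count: "countable (f ` frontier K)" by (rule countable_image_inj_on)
  have "connected (frontier K)"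
  proof -
    have ne: "interior K \<noteq> {}" using cint by blast
    then have "aff_dim K = 3" by (simp add: aff_dim_nonempty_interior)
    then have "connected (rel_frontier K)"
      using K by (intro connected_sphere_gen) (auto simp: compact_imp_bounded)
    then show ?thesis using ne by (simp add: rel_frontier_nonempty_interior)
  qed
  then have "connected (f ` frontier K)"
    unfolding f_def by (intro connected_continuous_image continuous_intros)
  moreover have "f ` frontier K \<noteq> {}"
    using frontier_eq_empty[of K] cint interior_subset[of K] compact_imp_bounded[OF K(1)] not_bounded_UNIV
    by auto
  \<comment> \<open>A connected set of reals with more than one point is uncountable.\<close>
  ultimately obtain R where R: "f ` frontier K = {R}"
    using count connected_uncountable by blast
  then have fR: "f x = R" if "x \<in> frontier K" for x using that by blast
  have Rpos: "R > 0"
  proof -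
    obtain x where "x \<in> frontier K" using R by blast
    then show ?thesis using fR frr assms(2) by fastforce
  qed
  have "K = cball c R"
  proof
    have "K = convex hull (frontier K)" using Krein_Milman_frontier K by blast
    also have "\<dots> \<subseteq> cball c R"
      using fR by (intro hull_minimal) (auto simp: f_def dist_norm norm_minus_commute)
    finally show "K \<subseteq> cball c R" .
    \<comment> \<open>Otherwise the connected ball, which meets \<open>K\<close> at
      \<open>c\<close>, would contain a boundary point at distance less than
      \<open>R\<close>.\<close>
    have "ball c R \<subseteq> K"
    proof (rule ccontr)
      assume "\<not> ball c R \<subseteq> K"
      moreover have "c \<in> ball c R \<inter> K" using Rpos cint interior_subset by auto
      ultimately have "ball c R \<inter> frontier K \<noteq> {}"
        by (intro connected_Int_frontier connected_ball) blast+
      then show False using fR by (auto simp: f_def dist_norm norm_minus_commute)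
    qed
    then have "closure (ball c R) \<subseteq> K" by (rule closure_minimal[OF _ clK])
    then show "cball c R \<subseteq> K" using Rpos by simp
  qed
  then show ?thesis using Rpos by blast
qed

end
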